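(* Let $f$ be a divergence with convex conjugate $g$, and let $X\in\mathcal{L}_{\bar g}$. Then for any $\varepsilon>0$, $$W_{g_\varepsilon}(X)\le\underline{R}_{f,\varepsilon}(X)\le\mathbb{E}_{\mathbb{P}}[X]\le\overline{R}_{f,\varepsilon}(X)\le V_{g_\varepsilon}(X).$$
   Context: All random variables are real-valued on a complete probability space $(\Omega,\mathcal{F},\mathbb{P})$; $\mathbb{E}_{\mathbb{Q}}$ denotes expectation under a probability measure $\mathbb{Q}$. A divergence is a proper, lower-semicontinuous, convex function $f:[0,+\infty)\to[0,+\infty)\cup\{+\infty\}$ such that $f(1)=0$, $f(x)<+\infty$ for every $x\ge 0$ (in particular $f(0)<+\infty$), and $f$ is twice continuously differentiable at every $x>0$. It is extended to $\mathbb{R}$ by $f(x)=+\infty$ for $x<0$. Its convex conjugate is $g(y)=\sup_{x\in\mathbb{R}}\{xy-f(x)\}$, $y\in\mathbb{R}$. For $\varepsilon>0$ set $g_\varepsilon(y)=\varepsilon^{-1}g(\varepsilon y)$, the convex conjugate of $f_\varepsilon=\varepsilon^{-1}f$. Define $\bar g(y)=0$ for $y<0$ and $\bar g(y)=g(y)$ for $y\ge 0$, and $\mathcal{L}_{\bar g}=\{X\mid \mathbb{E}_{\mathbb{P}}[\bar g(|X|/\lambda)]<+\infty\text{ for some }\lambda>0\}$. The upper- and lower-bounding Orlicz regrets are $$V_{g_\varepsilon}(X)=\inf_{t>0}\left\{t\left(1+\mathbb{E}_{\mathbb{P}}\left[g_\varepsilon\left(\tfrac{X}{t}\right)\right]\right)\right\},\qquad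 W_{g_\varepsilon}(X)=\sup_{t>0}\left\{-t\left(1+\mathbb{E}_{\mathbb{P}}\left[g_\varepsilon\left(\tfrac{-X}{t}\right)\right]\right)\right\}.$$ The upper- and lower-bounding divergence risk measures $\overline{R}_{f,\varepsilon}(X)$ and $\underline{R}_{f,\varepsilon}(X)$ are respectively the supremum and the infimum of $\mathbb{E}_{\mathbb{Q}}[X]$ over all probability measures $\mathbb{Q}$ absolutely continuous with respect to $\mathbb{P}$ with $\mathbb{E}_{\mathbb{P}}\left[f\left(\frac{d\mathbb{Q}}{d\mathbb{P}}\right)\right]\le\varepsilon$. *)

theory Defs
  imports "HOL-Probability.Probability"
begin

text \<open>
  Expectation of an extended-real-valued function: positive part minus negative part.
  Where it is used on \<open>g\<^sub>\<epsilon> (X / t)\<close> below, the form \<open>\<infinity> - \<infinity>\<close> (which is \<open>\<infinity>\<close> in type \<^typ>\<open>ereal\<close>) does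
  not arise for \<open>X\<close> in the Orlicz space: \<open>g y \<ge> y\<close> because \<open>f 1 = 0\<close>, and such \<open>X\<close> is integrable,
  so the negative part has finite integral.
\<close>

definition ext_expectation :: "'a measure \<Rightarrow> ('a \<Rightarrow> ereal) \<Rightarrow> ereal" where
  "ext_expectation M Y =
     enn2ereal (\<integral>\<^sup>+ \<omega>. e2ennreal (Y \<omega>) \<partial>M) - enn2ereal (\<integral>\<^sup>+ \<omega>. e2ennreal (- Y \<omega>) \<partial>M)"

text \<open>
  A divergence is finite on \<open>[0, \<infinity>)\<close>, hence a real function here; its values on negative
  arguments are irrelevant and are replaced by \<open>\<infinity>\<close> in \<open>extend_div\<close>.
\<close>

definition divergence :: "(real \<Rightarrow> real) \<Rightarrow> bool" where
  "divergence f \<longleftrightarrow>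
     (\<forall>x\<ge>0. 0 \<le> f x) \<and> f 1 = 0 \<and>
     convex_on {0..} f \<and>
     (\<forall>x\<ge>0. ereal (f x) \<le> Liminf (at x within {0..}) (\<lambda>y. ereal (f y))) \<and>
     (\<forall>x>0. f differentiable at x) \<and>
     (\<forall>x>0. deriv f differentiable at x) \<and>
     continuous_on {0<..} (deriv (deriv f))"

definition extend_div :: "(real \<Rightarrow> real) \<Rightarrow> real \<Rightarrow> ereal" where
  "extend_div f x = (if x < 0 then \<infinity> else ereal (f x))"

definition convex_conj :: "(real \<Rightarrow> ereal) \<Rightarrow> real \<Rightarrow> ereal" where
  "convex_conj F y = (SUP x. ereal (x * y) - F x)"

definition scale_conj :: "(real \<Rightarrow> ereal) \<Rightarrow> real \<Rightarrow> real \<Rightarrow> ereal" where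
  "scale_conj g \<epsilon> y = ereal (inverse \<epsilon>) * g (\<epsilon> * y)"

definition bar_conj :: "(real \<Rightarrow> ereal) \<Rightarrow> real \<Rightarrow> ereal" where
  "bar_conj g y = (if y < 0 then 0 else g y)"

definition orlicz_space :: "'a measure \<Rightarrow> (real \<Rightarrow> ereal) \<Rightarrow> ('a \<Rightarrow> real) set" where
  "orlicz_space P h =
     {X \<in> borel_measurable P. \<exists>l>0. ext_expectation P (\<lambda>\<omega>. h (\<bar>X \<omega>\<bar> / l)) < \<infinity>}"

definition upper_regret :: "'a measure \<Rightarrow> (real \<Rightarrow> ereal) \<Rightarrow> ('a \<Rightarrow> real) \<Rightarrow> ereal" where
  "upper_regret P h X =
     (INF t\<in>{0<..}. ereal t * (1 + ext_expectation P (\<lambda>\<omega>. h (X \<omega> / t))))"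

definition lower_regret :: "'a measure \<Rightarrow> (real \<Rightarrow> ereal) \<Rightarrow> ('a \<Rightarrow> real) \<Rightarrow> ereal" where
  "lower_regret P h X =
     (SUP t\<in>{0<..}. - ereal t * (1 + ext_expectation P (\<lambda>\<omega>. h (- X \<omega> / t))))"

text \<open>
  The density is \<open>P\<close>-almost everywhere finite, so \<open>enn2real\<close> alters it only on a null set.
\<close>

definition div_ball :: "'a measure \<Rightarrow> (real \<Rightarrow> real) \<Rightarrow> real \<Rightarrow> 'a measure set" where
  "div_ball P f \<epsilon> =
     {Q. prob_space Q \<and> sets Q = sets P \<and> absolutely_continuous P Q \<and>
         (\<integral>\<^sup>+ \<omega>. ennreal (f (enn2real (RN_deriv P Q \<omega>))) \<partial>P) \<le> ennreal \<epsilon>}"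

text \<open>
  For \<open>X\<close> in the Orlicz space, \<open>\<bar>X\<bar>\<close> is integrable under every \<open>Q\<close> in the ball, by the inequality
  \<open>x y \<le> f x + g y\<close> applied to \<open>x = dQ/dP\<close> and \<open>y = \<bar>X\<bar> / l\<close>; the Bochner integrals below are then
  genuine expectations.
\<close>

definition upper_risk :: "'a measure \<Rightarrow> (real \<Rightarrow> real) \<Rightarrow> real \<Rightarrow> ('a \<Rightarrow> real) \<Rightarrow> ereal" where
  "upper_risk P f \<epsilon> X = (SUP Q\<in>div_ball P f \<epsilon>. ereal (prob_space.expectation Q X))"

definition lower_risk :: "'a measure \<Rightarrow> (real \<Rightarrow> real) \<Rightarrow> real \<Rightarrow> ('a \<Rightarrow> real) \<Rightarrow> ereal" where
  "lower_risk P f \<epsilon> X = (INF Q\<in>div_ball P f \<epsilon>. ereal (prob_space.expectation Q X))"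

end

theory Submission
  imports Defs
begin

text \<open>
  For a density \<open>d = dQ/dP\<close> the Fenchel--Young
  inequality at \<open>x = d\<close>, \<open>y = \<epsilon> X / t\<close>, \<open>t > 0\<close>, reads \<open>d X \<le> (t / \<epsilon>) f d + t g\<^sub>\<epsilon> (X / t)\<close>, and integrating it
  with \<open>E (f d) \<le> \<epsilon>\<close> bounds the expectation of \<open>X\<close> under \<open>Q\<close>. The lower bound is the same inequality for \<open>- X\<close>,
  and the middle ones hold because \<open>P\<close> lies in the divergence ball.
\<close>

section \<open>Conjugate inequalities and measurability\<close>

lemma fenchel_young:
  assumes "0 \<le> x"
  shows "ereal (x * y - f x) \<le> convex_conj (extend_div f) y"
proof -
  have "ereal (x * y) - extend_div f x \<le> convex_conj (extend_div f) y"
    unfolding convex_conj_def by (rule SUP_upper) simp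
  with assms show ?thesis by (simp add: extend_div_def)
qed

text \<open>Fenchel--Young at \<open>x = 1\<close>, where \<open>f\<close> vanishes. It later
  supplies an integrable minorant of the scaled conjugate and the sign of the conjugate on
  nonnegative arguments.\<close>

lemma convex_conj_ge_self:
  assumes "divergence f"
  shows "ereal y \<le> convex_conj (extend_div f) y"
  using fenchel_young[of 1 y f] assms by (simp add: divergence_def)

text \<open>The supremum is uncountable, so measurability comes from topology: a supremum of
  continuous functions has open strict superlevel sets. For \<open>x < 0\<close> the term is
  constantly minus infinity and contributes the empty set.\<close>

lemma borel_measurable_convex_conj_extend_div [measurable]:
  "convex_conj (extend_div f) \<in> borel_measurable borel"
proof (rule borel_measurableI_greater)
  fix a :: ereal
  have eq: "{y. a < convex_conj (extend_div f) y}
      = (\<Union>x. {y. a < ereal (x * y) - extend_div f x})"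
    by (auto simp: convex_conj_def less_SUP_iff)
  have "open {y. a < ereal (x * y) - extend_div f x}" for x
  proof (cases "x < 0")
    case True
    then show ?thesis by (simp add: extend_div_def)
  next
    case False
    then have "{y. a < ereal (x * y) - extend_div f x} = {y. a < ereal (x * y - f x)}"
      by (simp add: extend_div_def)
    also have "open \<dots>"
      by (intro open_Collect_less continuous_intros)
    finally show ?thesis .
  qed
  then show "{y \<in> space borel. a < convex_conj (extend_div f) y} \<in> sets borel"
    by (simp add: eq open_UN borel_open)
qed

text \<open>Differentiability makes \<open>f\<close> continuous on the open half-line only. The
  point 0 is split off as a separate case, and the arbitrary values of \<open>f\<close> on negative
  arguments are never reached.\<close>

lemma borel_measurable_divergence_comp:
  assumes "divergence f" and d [measurable]: "d \<in> borel_measurable M"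
    and "\<And>\<omega>. 0 \<le> d \<omega>"
  shows "(\<lambda>\<omega>. f (d \<omega>)) \<in> borel_measurable M"
proof -
  have "continuous_on {0<..} f"
    using assms(1) by (auto simp: divergence_def
      intro!: differentiable_imp_continuous_on differentiable_at_imp_differentiable_on)
  then have [measurable]: "(\<lambda>x. indicator {0<..} x *\<^sub>R f x) \<in> borel_measurable borel"
    by (intro borel_measurable_continuous_on_indicator) auto
  have "(\<lambda>\<omega>. f (d \<omega>)) = (\<lambda>\<omega>. if d \<omega> = 0 then f 0 else indicator {0<..} (d \<omega>) *\<^sub>R f (d \<omega>))"
    using assms(3) by (auto simp: fun_eq_iff indicator_def not_less intro: antisym)
  also have "\<dots> \<in> borel_measurable M"
    by measurable
  finally show ?thesis .
qed

section \<open>Extended expectations as Bochner integrals\<close>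

lemma e2ennreal_eq_ennreal_real_of_ereal:
  assumes "x \<noteq> \<infinity>"
  shows "e2ennreal x = ennreal (real_of_ereal x)"
  using assms by (cases x) (auto simp: ennreal.abs_eq e2ennreal_neg)

text \<open>An integrable minorant makes the negative part of \<open>Y\<close> integrable. If the
  positive part has infinite integral, so is the expectation; otherwise \<open>Y\<close> is finite
  almost everywhere and an ordinary integral remains.\<close>

lemma ext_expectation_cases:
  assumes Y [measurable]: "Y \<in> borel_measurable M"
    and Z: "integrable M Z" and le: "\<And>\<omega>. ereal (Z \<omega>) \<le> Y \<omega>"
  obtains (infinite) "ext_expectation M Y = \<infinity>"
  | (finite) y where "integrable M y" "AE \<omega> in M. Y \<omega> = ereal (y \<omega>)"
      "ext_expectation M Y = ereal (\<integral>\<omega>. y \<omega> \<partial>M)"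
proof -
  have neg_le: "e2ennreal (- Y \<omega>) \<le> ennreal (norm (Z \<omega>))" for \<omega>
  proof -
    have "- Y \<omega> \<le> ereal \<bar>Z \<omega>\<bar>"
      using le[of \<omega>] by (cases "Y \<omega>") auto
    then have "e2ennreal (- Y \<omega>) \<le> e2ennreal (ereal \<bar>Z \<omega>\<bar>)"
      by (rule e2ennreal_mono)
    then show ?thesis by simp
  qed
  have "(\<integral>\<^sup>+\<omega>. e2ennreal (- Y \<omega>) \<partial>M) \<le> (\<integral>\<^sup>+\<omega>. ennreal (norm (Z \<omega>)) \<partial>M)"
    by (intro nn_integral_mono neg_le)
  also have "\<dots> < \<infinity>"
    using Z by (simp add: integrable_iff_bounded)
  finally have neg: "(\<integral>\<^sup>+\<omega>. e2ennreal (- Y \<omega>) \<partial>M) < \<infinity>" .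
  show ?thesis
  proof (cases "(\<integral>\<^sup>+\<omega>. e2ennreal (Y \<omega>) \<partial>M) = \<infinity>")
    case True
    have "enn2ereal (\<integral>\<^sup>+\<omega>. e2ennreal (- Y \<omega>) \<partial>M) \<noteq> \<infinity>"
      using neg by (metis enn2ereal_eq_top_iff infinity_ennreal_def less_irrefl)
    with True show ?thesis
      by (intro infinite) (simp add: ext_expectation_def)
  next
    case False
    define y where "y \<omega> = real_of_ereal (Y \<omega>)" for \<omega>
    have y [measurable]: "y \<in> borel_measurable M"
      unfolding y_def by measurable
    have "AE \<omega> in M. e2ennreal (Y \<omega>) \<noteq> \<infinity>"
      using False by (intro nn_integral_PInf_AE) auto
    then have fin: "AE \<omega> in M. Y \<omega> \<noteq> \<infinity>"
      by eventually_elim auto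
    have AE: "AE \<omega> in M. Y \<omega> = ereal (y \<omega>)"
      using fin
    \<comment> \<open>The minorant excludes minus infinity, so \<open>Y\<close> agrees with its real
      part.\<close>
    proof eventually_elim
      case (elim \<omega>)
      with le[of \<omega>] show ?case by (cases "Y \<omega>") (auto simp: y_def)
    qed
    have pos_eq: "(\<integral>\<^sup>+\<omega>. e2ennreal (Y \<omega>) \<partial>M) = (\<integral>\<^sup>+\<omega>. ennreal (y \<omega>) \<partial>M)"
      using AE by (intro nn_integral_cong_AE, eventually_elim)
        (simp add: e2ennreal_eq_ennreal_real_of_ereal)
    have neg_eq: "(\<integral>\<^sup>+\<omega>. e2ennreal (- Y \<omega>) \<partial>M) = (\<integral>\<^sup>+\<omega>. ennreal (- y \<omega>) \<partial>M)"
      using AE by (intro nn_integral_cong_AE, eventually_elim)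
        (simp add: e2ennreal_eq_ennreal_real_of_ereal)
    have int: "integrable M y"
      using False neg by (simp add: real_integrable_def pos_eq neg_eq)
    have "enn2ereal a = ereal (enn2real a)" if "a \<noteq> \<infinity>" for a
      using that by (cases a) (auto simp: enn2ereal_ennreal)
    then have "ext_expectation M Y = ereal (\<integral>\<omega>. y \<omega> \<partial>M)"
      using False neg
      by (simp add: ext_expectation_def real_lebesgue_integral_def[OF int] pos_eq neg_eq less_top)
    with int AE show ?thesis by (rule finite)
  qed
qed

section \<open>Integrability from the Orlicz condition\<close>

text \<open>Arguments \<open>\<bar>X \<omega>\<bar> / l\<close> are nonnegative, so
  \<open>bar_conj\<close> agrees with the conjugate there. With 0 as minorant, the finite Orlicz
  expectation leaves only the integrable case.\<close>

lemma orlicz_space_bound: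
  assumes "divergence f" "X \<in> orlicz_space P (bar_conj (convex_conj (extend_div f)))"
  obtains l G where "0 < l" "integrable P G"
    "AE \<omega> in P. convex_conj (extend_div f) (\<bar>X \<omega>\<bar> / l) = ereal (G \<omega>)"
proof -
  let ?g = "convex_conj (extend_div f)"
  from assms(2) obtain l where X [measurable]: "X \<in> borel_measurable P" and l: "0 < l"
    and fin: "ext_expectation P (\<lambda>\<omega>. bar_conj ?g (\<bar>X \<omega>\<bar> / l)) < \<infinity>"
    by (auto simp: orlicz_space_def)
  have bar: "bar_conj ?g (\<bar>X \<omega>\<bar> / l) = ?g (\<bar>X \<omega>\<bar> / l)" for \<omega>
    using l by (simp add: bar_conj_def flip: not_le)
  have nonneg: "0 \<le> ?g (\<bar>X \<omega>\<bar> / l)" for \<omega>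
  proof -
    have "0 \<le> ereal (\<bar>X \<omega>\<bar> / l)" using l by simp
    also have "\<dots> \<le> ?g (\<bar>X \<omega>\<bar> / l)" by (rule convex_conj_ge_self[OF assms(1)])
    finally show ?thesis .
  qed
  have "(\<lambda>\<omega>. ?g (\<bar>X \<omega>\<bar> / l)) \<in> borel_measurable P"
    by measurable
  moreover have "integrable P (\<lambda>_. 0 :: real)"
    by simp
  moreover have "ereal 0 \<le> ?g (\<bar>X \<omega>\<bar> / l)" for \<omega>
    using nonneg by (simp flip: zero_ereal_def)
  ultimately show thesis
  proof (cases rule: ext_expectation_cases)
    case infinite
    with fin show ?thesis by (simp add: bar)
  next
    case (finite y)
    with l that show ?thesis by blast
  qed
qed

text \<open>Fenchel--Young at \<open>x = d\<close> and \<open>y = \<bar>X\<bar> / l\<close>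
  dominates \<open>d * \<bar>X\<bar>\<close> by the integrable function
  \<open>l * (f d + G)\<close>.\<close>

lemma orlicz_space_integrable:
  assumes "divergence f" "X \<in> orlicz_space P (bar_conj (convex_conj (extend_div f)))"
    and d [measurable]: "d \<in> borel_measurable P" and d0: "\<And>\<omega>. 0 \<le> d \<omega>"
    and fd: "integrable P (\<lambda>\<omega>. f (d \<omega>))"
  shows "integrable P (\<lambda>\<omega>. d \<omega> * X \<omega>)"
proof -
  obtain l G where l: "0 < l" and G: "integrable P G"
    "AE \<omega> in P. convex_conj (extend_div f) (\<bar>X \<omega>\<bar> / l) = ereal (G \<omega>)"
    using orlicz_space_bound[OF assms(1,2)] .
  have X [measurable]: "X \<in> borel_measurable P"
    using assms(2) by (simp add: orlicz_space_def)
  show ?thesis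
  proof (rule Bochner_Integration.integrable_bound)
    show "integrable P (\<lambda>\<omega>. l * (f (d \<omega>) + G \<omega>))"
      using fd G(1) by simp
    show "AE \<omega> in P. norm (d \<omega> * X \<omega>) \<le> norm (l * (f (d \<omega>) + G \<omega>))"
      using G(2)
    proof eventually_elim
      case (elim \<omega>)
      have "d \<omega> * (\<bar>X \<omega>\<bar> / l) \<le> f (d \<omega>) + G \<omega>"
        using fenchel_young[OF d0, of \<omega> "\<bar>X \<omega>\<bar> / l" f] elim by simp
      then have "d \<omega> * \<bar>X \<omega>\<bar> \<le> l * (f (d \<omega>) + G \<omega>)"
        using l by (simp add: field_simps)
      then show ?case
        using abs_ge_self[of "l * (f (d \<omega>) + G \<omega>)"] d0[of \<omega>]
        unfolding real_norm_def by (simp only: abs_mult abs_of_nonneg)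
    qed
  qed measurable
qed

section \<open>Densities in the divergence ball\<close>

text \<open>The real-valued Radon--Nikodym derivative serves as \<open>d\<close>. Since
  \<open>f d\<close> is nonnegative, the bound on its nonnegative integral yields both integrability
  and the bound on its Bochner integral.\<close>

lemma div_ball_density:
  assumes "prob_space P" "divergence f" "0 < \<epsilon>" "Q \<in> div_ball P f \<epsilon>"
  obtains d where "d \<in> borel_measurable P" "\<And>\<omega>. 0 \<le> d \<omega>"
    "integrable P (\<lambda>\<omega>. f (d \<omega>))" "(\<integral>\<omega>. f (d \<omega>) \<partial>P) \<le> \<epsilon>"
    "\<And>X. X \<in> borel_measurable P \<Longrightarrow> (\<integral>\<omega>. X \<omega> \<partial>Q) = (\<integral>\<omega>. d \<omega> * X \<omega> \<partial>P)"
proof -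
  interpret P: prob_space P by fact
  from assms(4) have Q: "prob_space Q" "sets Q = sets P" "absolutely_continuous P Q"
    and le: "(\<integral>\<^sup>+ \<omega>. ennreal (f (enn2real (RN_deriv P Q \<omega>))) \<partial>P) \<le> ennreal \<epsilon>"
    by (auto simp: div_ball_def)
  interpret Q: prob_space Q by fact
  define d where "d \<omega> = enn2real (RN_deriv P Q \<omega>)" for \<omega>
  have d [measurable]: "d \<in> borel_measurable P"
    unfolding d_def by measurable
  have d0: "0 \<le> d \<omega>" for \<omega> by (simp add: d_def)
  have f0: "0 \<le> f (d \<omega>)" for \<omega>
    using assms(2) d0 by (simp add: divergence_def)
  have fd [measurable]: "(\<lambda>\<omega>. f (d \<omega>)) \<in> borel_measurable P"
    by (rule borel_measurable_divergence_comp[OF assms(2) d d0])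
  have int: "integrable P (\<lambda>\<omega>. f (d \<omega>))"
    using le fd f0
    by (intro integrableI_nonneg) (auto simp: d_def less_top[symmetric] top_unique)
  have "ennreal (\<integral>\<omega>. f (d \<omega>) \<partial>P) \<le> ennreal \<epsilon>"
    using le nn_integral_eq_integral[OF int] f0 by (simp add: d_def)
  then have "(\<integral>\<omega>. f (d \<omega>) \<partial>P) \<le> \<epsilon>"
    using assms(3) by (simp add: ennreal_le_iff)
  moreover have "(\<integral>\<omega>. X \<omega> \<partial>Q) = (\<integral>\<omega>. d \<omega> * X \<omega> \<partial>P)" if "X \<in> borel_measurable P" for X
    unfolding d_def using P.RN_deriv_integral[OF Q.sigma_finite_measure_axioms Q(3,2) that] .
  ultimately show thesis
    using that[OF d d0 int] by blast
qed

text \<open>The density of \<open>P\<close> with respect to itself is 1 almost everywhere and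
  \<open>f 1 = 0\<close>, so the divergence is zero.\<close>

lemma self_in_div_ball:
  assumes "prob_space P" "divergence f"
  shows "P \<in> div_ball P f \<epsilon>"
proof -
  interpret P: prob_space P by fact
  have "density P (\<lambda>_. 1) = P"
    by (rule density_1)
  then have "AE \<omega> in P. 1 = RN_deriv P P \<omega>"
    by (intro P.RN_deriv_unique) auto
  then have "AE \<omega> in P. ennreal (f (enn2real (RN_deriv P P \<omega>))) = 0"
  proof eventually_elim
    case (elim \<omega>)
    then show ?case using assms(2) by (simp add: divergence_def flip: elim)
  qed
  then have "(\<integral>\<^sup>+ \<omega>. ennreal (f (enn2real (RN_deriv P P \<omega>))) \<partial>P) = (\<integral>\<^sup>+ \<omega>. 0 \<partial>P)"
    by (rule nn_integral_cong_AE)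
  with assms(1) show ?thesis
    by (simp add: div_ball_def absolutely_continuous_def)
qed

section \<open>Comparison of risks with regrets\<close>

text \<open>Fixing both \<open>Q\<close> and \<open>t\<close> keeps the estimate to a single
  integrated inequality; the supremum over \<open>Q\<close> and the infimum over \<open>t\<close>
  are then taken independently.\<close>

lemma expectation_le_regret_objective:
  assumes P: "prob_space P" and f: "divergence f" and \<epsilon>: "0 < \<epsilon>"
    and X: "X \<in> orlicz_space P (bar_conj (convex_conj (extend_div f)))"
    and Q: "Q \<in> div_ball P f \<epsilon>" and t: "0 < t"
  shows "ereal (\<integral>\<omega>. X \<omega> \<partial>Q)
    \<le> ereal t * (1 + ext_expectation P (\<lambda>\<omega>. scale_conj (convex_conj (extend_div f)) \<epsilon> (X \<omega> / t)))"
proof -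
  interpret P: prob_space P by fact
  let ?g = "convex_conj (extend_div f)"
  have Xm [measurable]: "X \<in> borel_measurable P"
    using X by (simp add: orlicz_space_def)
  obtain d where d: "d \<in> borel_measurable P" "\<And>\<omega>. 0 \<le> d \<omega>"
    "integrable P (\<lambda>\<omega>. f (d \<omega>))" "(\<integral>\<omega>. f (d \<omega>) \<partial>P) \<le> \<epsilon>"
    "(\<integral>\<omega>. X \<omega> \<partial>Q) = (\<integral>\<omega>. d \<omega> * X \<omega> \<partial>P)"
    using div_ball_density[OF P f \<epsilon> Q] Xm by metis
  note dX = orlicz_space_integrable[OF f X d(1-3)]
  \<comment> \<open>The constant density 1 has \<open>f 1 = 0\<close>, so \<open>X\<close> itself is
    integrable under \<open>P\<close>.\<close>
  have "integrable P (\<lambda>\<omega>. 1 * X \<omega>)"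
    by (rule orlicz_space_integrable[OF f X]) auto
  then have Xt: "integrable P (\<lambda>\<omega>. X \<omega> / t)" by simp
  \<comment> \<open>Used with \<open>c = \<epsilon> * y\<close> for the minorant, and with the
    Fenchel--Young bound at \<open>d\<close> for the main estimate.\<close>
  have scale: "ereal (inverse \<epsilon> * c) \<le> scale_conj ?g \<epsilon> y" if "ereal c \<le> ?g (\<epsilon> * y)" for c y
    using ereal_mult_left_mono[OF that, of "ereal (inverse \<epsilon>)"] \<epsilon>
    by (simp add: scale_conj_def)
  have lower: "ereal (X \<omega> / t) \<le> scale_conj ?g \<epsilon> (X \<omega> / t)" for \<omega>
    using scale[OF convex_conj_ge_self[OF f], of "X \<omega> / t"] \<epsilon> by (simp add: field_simps)
  have "(\<lambda>\<omega>. scale_conj ?g \<epsilon> (X \<omega> / t)) \<in> borel_measurable P"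
    unfolding scale_conj_def by measurable
  from this Xt lower show ?thesis
  proof (cases rule: ext_expectation_cases)
    \<comment> \<open>The right-hand side is infinite because \<open>t\<close> is positive.\<close>
    case infinite
    with t show ?thesis by simp
  next
    case (finite y)
    have "(\<integral>\<omega>. d \<omega> * X \<omega> \<partial>P) \<le> (\<integral>\<omega>. t / \<epsilon> * f (d \<omega>) + t * y \<omega> \<partial>P)"
    proof (rule integral_mono_AE[OF dX])
      show "integrable P (\<lambda>\<omega>. t / \<epsilon> * f (d \<omega>) + t * y \<omega>)"
        using d(3) finite(1) by simp
      show "AE \<omega> in P. d \<omega> * X \<omega> \<le> t / \<epsilon> * f (d \<omega>) + t * y \<omega>"
        using finite(2)
      proof eventually_elim
        case (elim \<omega>)
        have "inverse \<epsilon> * (d \<omega> * (\<epsilon> * (X \<omega> / t)) - f (d \<omega>)) \<le> y \<omega>"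
          using scale[OF fenchel_young[OF d(2)], of \<omega> "X \<omega> / t"] elim by simp
        then show ?case using \<epsilon> t by (simp add: field_simps)
      qed
    qed
    also have "\<dots> = t / \<epsilon> * (\<integral>\<omega>. f (d \<omega>) \<partial>P) + t * (\<integral>\<omega>. y \<omega> \<partial>P)"
      using d(3) finite(1) by simp
    \<comment> \<open>The ball constraint enters here: the divergence term is at most
      \<open>t\<close>, which is the summand 1 in the regret after factoring out
      \<open>t\<close>.\<close>
    also have "\<dots> \<le> t / \<epsilon> * \<epsilon> + t * (\<integral>\<omega>. y \<omega> \<partial>P)"
      using d(4) \<epsilon> t by (intro add_right_mono mult_left_mono) auto
    also have "\<dots> = t * (1 + (\<integral>\<omega>. y \<omega> \<partial>P))"
      using \<epsilon> by (simp add: algebra_simps)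
    finally show ?thesis
      by (simp add: d(5) finite(3) one_ereal_def)
  qed
qed

theorem proposition4:
  fixes P :: "'a measure" and f :: "real \<Rightarrow> real" and g :: "real \<Rightarrow> ereal"
    and X :: "'a \<Rightarrow> real" and \<epsilon> :: real
  assumes "prob_space P" and "complete_measure P"
    and "divergence f" and "g = convex_conj (extend_div f)"
    and "X \<in> orlicz_space P (bar_conj g)"
    and "\<epsilon> > 0"
  shows "lower_regret P (scale_conj g \<epsilon>) X \<le> lower_risk P f \<epsilon> X
    \<and> lower_risk P f \<epsilon> X \<le> ereal (prob_space.expectation P X)
    \<and> ereal (prob_space.expectation P X) \<le> upper_risk P f \<epsilon> X
    \<and> upper_risk P f \<epsilon> X \<le> upper_regret P (scale_conj g \<epsilon>) X"
proof (intro conjI)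
  note X = assms(5)[unfolded assms(4)]
  \<comment> \<open>Membership in the Orlicz space depends on \<open>X\<close> only through
    measurability and \<open>\<bar>X\<bar>\<close>.\<close>
  have neg_X: "(\<lambda>\<omega>. - X \<omega>) \<in> orlicz_space P (bar_conj (convex_conj (extend_div f)))"
    using X by (simp add: orlicz_space_def)
  note P = self_in_div_ball[OF assms(1,3), of \<epsilon>]
  show "lower_risk P f \<epsilon> X \<le> ereal (prob_space.expectation P X)"
    unfolding lower_risk_def by (rule INF_lower[OF P])
  show "ereal (prob_space.expectation P X) \<le> upper_risk P f \<epsilon> X"
    unfolding upper_risk_def by (rule SUP_upper[OF P])
  show "upper_risk P f \<epsilon> X \<le> upper_regret P (scale_conj g \<epsilon>) X"
    unfolding upper_risk_def upper_regret_def assms(4)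
    using expectation_le_regret_objective[OF assms(1,3,6) X]
    by (intro SUP_least INF_greatest) simp
  show "lower_regret P (scale_conj g \<epsilon>) X \<le> lower_risk P f \<epsilon> X"
    unfolding lower_risk_def lower_regret_def assms(4)
  proof (intro SUP_least INF_greatest)
    fix t :: real and Q
    assume "t \<in> {0<..}" and Q: "Q \<in> div_ball P f \<epsilon>"
    then have "ereal (\<integral>\<omega>. - X \<omega> \<partial>Q) \<le> ereal t * (1 + ext_expectation P
        (\<lambda>\<omega>. scale_conj (convex_conj (extend_div f)) \<epsilon> (- X \<omega> / t)))"
      using expectation_le_regret_objective[OF assms(1,3,6) neg_X Q] by simp
    \<comment> \<open>Pulling the sign out of the product and negating both sides turns the upper
      bound for \<open>- X\<close> into a lower bound for \<open>X\<close>.\<close>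
    then show "- ereal t * (1 + ext_expectation P
        (\<lambda>\<omega>. scale_conj (convex_conj (extend_div f)) \<epsilon> (- X \<omega> / t))) \<le> ereal (\<integral>\<omega>. X \<omega> \<partial>Q)"
      unfolding ereal_mult_minus_left by (subst ereal_uminus_le_reorder) simp
  qed
qed

end
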